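(* Let $n\geq 2$ and $M\geq 1$ be integers, and let $\{X_t\}_{t=0,1,2,\ldots}$ be the $n$-urn Ehrenfest chain with $M$ balls on $\{1,\ldots,n\}^M$. For any two different configurations $(a_1,\ldots,a_M),(b_1,\ldots,b_M)\in\{1,\ldots,n\}^M$, let $L=\#\{i\in\{1,\ldots,M\}: a_i=b_i\}$. Then $$\mathbb{E}\bigl(T_{(b_1,\ldots,b_M)}\,\big|\,X_0=(a_1,\ldots,a_M)\bigr)=\sum_{k=L}^{M-1}\frac{(n-1)^{k+1}}{\binom{M-1}{k}}\sum_{i=0}^k\frac{\binom{M}{i}}{(n-1)^i}.$$
   Context: The $n$-urn Ehrenfest chain with $M$ balls is the time-homogeneous Markov chain $X_t=(X_t^{(1)},\ldots,X_t^{(M)})$, $t=0,1,2,\ldots$, on $\{1,\ldots,n\}^M$ ($X_t^{(i)}$ is the label of the urn containing ball $i$ at time $t$) with transition probabilities $p_{x,y}=\frac{1}{(n-1)M}$ if $x=(x_1,\ldots,x_M)$ and $y=(y_1,\ldots,y_M)$ differ in exactly one coordinate, and $p_{x,y}=0$ otherwise. That is, at each step a uniformly random ball is moved to a uniformly random one of the other $n-1$ urns. For $x\in\{1,\ldots,n\}^M$, $T_x=\inf\{t\geq 0: X_t=x\}$ is the hitting time of $x$. *)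

theory Defs
  imports "HOL-Probability.Probability"
begin

text \<open>A time-homogeneous Markov chain \<open>X\<close> in discrete time on the countable state space \<open>S\<close>
  with transition probabilities \<open>p x y\<close> and arbitrary initial distribution. The transition
  law is required conditionally on every history of positive probability.\<close>

locale discrete_markov_chain = prob_space P
  for P :: "'w measure" and S :: "'s set" and p :: "'s \<Rightarrow> 's \<Rightarrow> real" and X :: "nat \<Rightarrow> 'w \<Rightarrow> 's" +
  assumes countable_states: "countable S"
    and random_variable_X: "\<And>t. X t \<in> measurable P (count_space S)"
    and markov: "\<And>t x. (\<And>s. s \<le> Suc t \<Longrightarrow> x s \<in> S) \<Longrightarrow>
      measure P {\<omega> \<in> space P. \<forall>s\<le>t. X s \<omega> = x s} > 0 \<Longrightarrow>
      cond_prob P (\<lambda>\<omega>. X (Suc t) \<omega> = x (Suc t)) (\<lambda>\<omega>. \<forall>s\<le>t. X s \<omega> = x s) = p (x t) (x (Suc t))"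

text \<open>Configurations are extensional functions on the set of balls \<open>{1..M}\<close>, so that equality of
  functions is equality of the tuples \<open>(x 1, \<dots>, x M)\<close>.\<close>

definition configs :: "nat \<Rightarrow> nat \<Rightarrow> (nat \<Rightarrow> nat) set" where
  "configs n M = {1..M} \<rightarrow>\<^sub>E {1..n}"

definition ehrenfest_trans :: "nat \<Rightarrow> nat \<Rightarrow> (nat \<Rightarrow> nat) \<Rightarrow> (nat \<Rightarrow> nat) \<Rightarrow> real" where
  "ehrenfest_trans n M x y =
    (if card {i \<in> {1..M}. x i \<noteq> y i} = 1 then 1 / ((real n - 1) * real M) else 0)"

definition ehrenfest_chain ::
    "nat \<Rightarrow> nat \<Rightarrow> 'w measure \<Rightarrow> (nat \<Rightarrow> 'w \<Rightarrow> nat \<Rightarrow> nat) \<Rightarrow> bool" where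
  "ehrenfest_chain n M P X \<longleftrightarrow> discrete_markov_chain P (configs n M) (ehrenfest_trans n M) X"

text \<open>The infimum is taken in \<^typ>\<open>enat\<close>: it is \<open>\<infinity>\<close> if \<open>x\<close> is never visited.\<close>

definition hitting_time :: "(nat \<Rightarrow> 'w \<Rightarrow> 's) \<Rightarrow> 's \<Rightarrow> 'w \<Rightarrow> enat" where
  "hitting_time X x \<omega> = Inf {enat t |t. X t \<omega> = x}"

text \<open>The elementary conditional expectation given an event \<open>A\<close> of positive probability, i.e. the
  expectation under \<^term>\<open>uniform_measure P A\<close>, which is the conditional measure
  \<open>B \<mapsto> P (A \<inter> B) / P A\<close>. It takes values in \<open>[0, \<infinity>]\<close>.\<close>

definition cond_expectation :: "'w measure \<Rightarrow> ('w \<Rightarrow> ennreal) \<Rightarrow> 'w set \<Rightarrow> ennreal" where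
  "cond_expectation P f A = (\<integral>\<^sup>+ \<omega>. f \<omega> \<partial>uniform_measure P A)"

end

theory Submission imports Defs begin

text \<open>If \<open>h \<ge> 0\<close> on a finite state space satisfies \<open>h b = 0\<close> and the one-step equation
  \<open>h x = 1 + (\<Sum>y. p x y * h y)\<close> for \<open>x \<noteq> b\<close>, then \<open>h\<close> is the expected hitting time of \<open>b\<close>. For
  the Ehrenfest chain the number of balls already in their target urn is itself a Markov chain, a
  birth-and-death chain, so a function of this number suffices. With \<open>D L = h L - h (L + 1)\<close> the
  one-step equation becomes \<open>(M - L) * D L = (n - 1) * M + (n - 1) * L * D (L - 1)\<close>, and the
  summand with index \<open>L\<close> in the claimed formula solves it because
  \<open>(M - L) * (M choose L) = M * ((M - 1) choose L)\<close> and
  \<open>L * (M choose L) = M * ((M - 1) choose (L - 1))\<close>.\<close>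

section \<open>Tail events and measurability of hitting times\<close>

text \<open>Tail events depend only on finitely many times, and the strict inequality also covers
  the value \<open>\<infinity>\<close>. They are the events summed in the formula for the
  expectation.\<close>

lemma less_hitting_time_iff: "enat t < hitting_time X b \<omega> \<longleftrightarrow> (\<forall>s\<le>t. X s \<omega> \<noteq> b)"
proof
  assume *: "enat t < hitting_time X b \<omega>"
  show "\<forall>s\<le>t. X s \<omega> \<noteq> b"
  proof (intro allI impI notI)
    fix s assume "s \<le> t" "X s \<omega> = b"
    then have "hitting_time X b \<omega> \<le> enat s"
      unfolding hitting_time_def by (intro Inf_lower) auto
    also have "\<dots> \<le> enat t" using \<open>s \<le> t\<close> by simp
    finally show False using * by simp
  qed
next
  assume *: "\<forall>s\<le>t. X s \<omega> \<noteq> b"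
  \<comment> \<open>Shifting to \<open>Suc t\<close> turns the strict inequality into a lower bound
    on an infimum.\<close>
  have "enat (Suc t) \<le> hitting_time X b \<omega>"
    unfolding hitting_time_def
  proof (rule Inf_greatest)
    fix u assume "u \<in> {enat s |s. X s \<omega> = b}"
    then show "enat (Suc t) \<le> u" using * not_less_eq_eq by fastforce
  qed
  then show "enat t < hitting_time X b \<omega>" by (simp add: Suc_ile_eq)
qed

context discrete_markov_chain
begin

lemma X_in_states: "\<omega> \<in> space P \<Longrightarrow> X t \<omega> \<in> S"
  using measurable_space[OF random_variable_X] by simp

lemma sets_X [measurable]: "{\<omega> \<in> space P. X t \<omega> = x} \<in> sets P"
proof -
  \<comment> \<open>\<open>x\<close> need not be a state; intersecting with \<open>S\<close> yields
    a measurable set of \<open>count_space S\<close>.\<close>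
  have "{\<omega> \<in> space P. X t \<omega> = x} = X t -` ({x} \<inter> S) \<inter> space P"
    using X_in_states by auto
  also have "\<dots> \<in> sets P"
    by (rule measurable_sets[OF random_variable_X]) auto
  finally show ?thesis .
qed

lemma sets_hitting_time_greater: "{\<omega> \<in> space P. enat t < hitting_time X b \<omega>} \<in> sets P"
  unfolding less_hitting_time_iff by measurable

text \<open>Needed for the tail-sum formula. As \<open>enat\<close> is countable, level sets
  suffice, and each of them is a countable Boolean combination of tail events.\<close>

lemma measurable_hitting_time: "hitting_time X b \<in> measurable P (count_space UNIV)"
proof (rule measurable_count_space_eq_countable[THEN iffD2])
  show "countable (UNIV :: enat set)" by simp
  have gt [measurable]: "Measurable.pred P (\<lambda>\<omega>. enat t < hitting_time X b \<omega>)" for t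
    using sets_hitting_time_greater by (simp add: pred_def)
  have inf: "hitting_time X b \<omega> = \<infinity> \<longleftrightarrow> (\<forall>t. enat t < hitting_time X b \<omega>)" for \<omega>
    by (metis enat_ord_simps(4) not_infinity_eq order.irrefl)
  have fin: "hitting_time X b \<omega> = enat t \<longleftrightarrow>
    \<not> enat t < hitting_time X b \<omega> \<and> (\<forall>s<t. enat s < hitting_time X b \<omega>)" for t \<omega>
  proof (cases "hitting_time X b \<omega>")
    case (enat k)
    then show ?thesis by (auto simp: not_less) (metis less_irrefl linorder_less_linear not_less)
  qed simp
  have *: "{\<omega> \<in> space P. hitting_time X b \<omega> = e} \<in> sets P" for e
  proof (cases e)
    case (enat k)
    then show ?thesis unfolding enat fin by measurable
  next
    case infinity
    then show ?thesis unfolding infinity inf by measurable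
  qed
  have "hitting_time X b -` {e} \<inter> space P = {\<omega> \<in> space P. hitting_time X b \<omega> = e}" for e by auto
  then show "hitting_time X b \<in> space P \<rightarrow> UNIV \<and>
      (\<forall>e\<in>UNIV. hitting_time X b -` {e} \<inter> space P \<in> sets P)"
    using * by simp
qed

section \<open>Markov property for sets of histories, and hitting times from one-step
  equations\<close>

text \<open>Multiplying \<open>markov\<close> out removes its positivity condition: for a null
  history both sides vanish.\<close>

lemma prob_history_step:
  assumes "\<And>s. s \<le> Suc t \<Longrightarrow> g s \<in> S"
  shows "prob {\<omega> \<in> space P. (\<forall>s\<le>t. X s \<omega> = g s) \<and> X (Suc t) \<omega> = g (Suc t)}
    = prob {\<omega> \<in> space P. \<forall>s\<le>t. X s \<omega> = g s} * p (g t) (g (Suc t))"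
proof (cases "prob {\<omega> \<in> space P. \<forall>s\<le>t. X s \<omega> = g s} = 0")
  case True
  have "prob {\<omega> \<in> space P. (\<forall>s\<le>t. X s \<omega> = g s) \<and> X (Suc t) \<omega> = g (Suc t)}
      \<le> prob {\<omega> \<in> space P. \<forall>s\<le>t. X s \<omega> = g s}"
    by (rule finite_measure_mono) (auto, measurable)
  then show ?thesis using True by (simp add: measure_le_0_iff)
next
  case False
  then have pos: "prob {\<omega> \<in> space P. \<forall>s\<le>t. X s \<omega> = g s} > 0"
    by (simp add: zero_less_measure_iff)
  have "cond_prob P (\<lambda>\<omega>. X (Suc t) \<omega> = g (Suc t)) (\<lambda>\<omega>. \<forall>s\<le>t. X s \<omega> = g s) = p (g t) (g (Suc t))"
    using assms pos by (rule markov)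
  then show ?thesis using pos unfolding cond_prob_def by (simp add: field_simps conj_commute)
qed

text \<open>\<open>H\<close> is the set of histories up to time \<open>t\<close> defining an event, and its elements are
  extensional so that distinct histories give disjoint events.\<close>

lemma prob_markov_step:
  assumes "finite S" "x \<in> S" "y \<in> S" "H \<subseteq> {..t} \<rightarrow>\<^sub>E S" and H_x: "\<And>g. g \<in> H \<Longrightarrow> g t = x"
  shows "prob {\<omega> \<in> space P. restrict (\<lambda>s. X s \<omega>) {..t} \<in> H \<and> X (Suc t) \<omega> = y}
    = prob {\<omega> \<in> space P. restrict (\<lambda>s. X s \<omega>) {..t} \<in> H} * p x y"
proof -
  have fin: "finite H"
    using assms(1,4) finite_PiE[of "{..t}" "\<lambda>_. S"] finite_subset by blast
  have eq_iff: "restrict (\<lambda>s. X s \<omega>) {..t} = g \<longleftrightarrow> (\<forall>s\<le>t. X s \<omega> = g s)" if "g \<in> H" for g \<omega>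
  proof -
    have "g \<in> extensional {..t}" using that assms(4) by (auto simp: PiE_def)
    then show ?thesis by (auto simp: fun_eq_iff restrict_def extensional_def)
  qed
  \<comment> \<open>Stated for general \<open>Q\<close> so that both sides of the claim split over
    \<open>H\<close>: once with the next state fixed, once with \<open>Q\<close> trivial.\<close>
  have split: "prob {\<omega> \<in> space P. restrict (\<lambda>s. X s \<omega>) {..t} \<in> H \<and> Q \<omega>}
      = (\<Sum>g\<in>H. prob {\<omega> \<in> space P. (\<forall>s\<le>t. X s \<omega> = g s) \<and> Q \<omega>})"
    if [measurable]: "Measurable.pred P Q" for Q
  proof -
    have "{\<omega> \<in> space P. restrict (\<lambda>s. X s \<omega>) {..t} \<in> H \<and> Q \<omega>}
        = (\<Union>g\<in>H. {\<omega> \<in> space P. (\<forall>s\<le>t. X s \<omega> = g s) \<and> Q \<omega>})"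
    proof (intro equalityI subsetI)
      fix \<omega> assume "\<omega> \<in> {\<omega> \<in> space P. restrict (\<lambda>s. X s \<omega>) {..t} \<in> H \<and> Q \<omega>}"
      then show "\<omega> \<in> (\<Union>g\<in>H. {\<omega> \<in> space P. (\<forall>s\<le>t. X s \<omega> = g s) \<and> Q \<omega>})"
        by (intro UN_I[of "restrict (\<lambda>s. X s \<omega>) {..t}"]) auto
    next
      fix \<omega> assume "\<omega> \<in> (\<Union>g\<in>H. {\<omega> \<in> space P. (\<forall>s\<le>t. X s \<omega> = g s) \<and> Q \<omega>})"
      then obtain g where g: "g \<in> H" "\<omega> \<in> space P" "\<forall>s\<le>t. X s \<omega> = g s" "Q \<omega>" by blast
      then have "restrict (\<lambda>s. X s \<omega>) {..t} = g" using eq_iff by blast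
      then show "\<omega> \<in> {\<omega> \<in> space P. restrict (\<lambda>s. X s \<omega>) {..t} \<in> H \<and> Q \<omega>}"
        using g by simp
    qed
    moreover have "disjoint_family_on (\<lambda>g. {\<omega> \<in> space P. (\<forall>s\<le>t. X s \<omega> = g s) \<and> Q \<omega>}) H"
      unfolding disjoint_family_on_def
    proof (intro ballI impI equals0I)
      fix g g' \<omega> assume "g \<in> H" "g' \<in> H" "g \<noteq> g'"
        and "\<omega> \<in> {\<omega> \<in> space P. (\<forall>s\<le>t. X s \<omega> = g s) \<and> Q \<omega>}
          \<inter> {\<omega> \<in> space P. (\<forall>s\<le>t. X s \<omega> = g' s) \<and> Q \<omega>}"
      then have "restrict (\<lambda>s. X s \<omega>) {..t} = g" "restrict (\<lambda>s. X s \<omega>) {..t} = g'"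
        using eq_iff by blast+
      then show False using \<open>g \<noteq> g'\<close> by simp
    qed
    ultimately show ?thesis
      using fin by (simp add: finite_measure_finite_Union image_subset_iff)
  qed
  have "prob {\<omega> \<in> space P. (\<forall>s\<le>t. X s \<omega> = g s) \<and> X (Suc t) \<omega> = y}
      = prob {\<omega> \<in> space P. \<forall>s\<le>t. X s \<omega> = g s} * p x y" if "g \<in> H" for g
  proof -
    \<comment> \<open>\<open>prob_history_step\<close> speaks of one path up to
      \<open>Suc t\<close>, so \<open>g\<close> is prolonged by \<open>y\<close>.\<close>
    have "(g(Suc t := y)) s \<in> S" if "s \<le> Suc t" for s
    proof (cases "s = Suc t")
      case False
      have "g \<in> {..t} \<rightarrow>\<^sub>E S" using \<open>g \<in> H\<close> assms(4) by blast
      then show ?thesis using PiE_mem[of g "{..t}" "\<lambda>_. S" s] that False by simp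
    qed (use assms(3) in simp)
    from prob_history_step[of t "g(Suc t := y)", OF this] show ?thesis
      using H_x[OF that] by (simp cong: conj_cong)
  qed
  then have "prob {\<omega> \<in> space P. restrict (\<lambda>s. X s \<omega>) {..t} \<in> H \<and> X (Suc t) \<omega> = y}
    = (\<Sum>g\<in>H. prob {\<omega> \<in> space P. \<forall>s\<le>t. X s \<omega> = g s}) * p x y"
    by (subst split) (auto simp: sum_distrib_right intro!: sum.cong)
  also have "(\<Sum>g\<in>H. prob {\<omega> \<in> space P. \<forall>s\<le>t. X s \<omega> = g s})
      = prob {\<omega> \<in> space P. restrict (\<lambda>s. X s \<omega>) {..t} \<in> H}"
    using split[of "\<lambda>_. True"] by simp
  finally show ?thesis .
qed

text \<open>By the recurrence, \<open>m t = E (h (X t); X 0 = a, T > t)\<close> decreases by \<open>P (X 0 = a, T > t)\<close> in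
  step \<open>t\<close>, as \<open>h b = 0\<close> removes the paths hitting \<open>b\<close> at time \<open>t + 1\<close>. Summability of the
  decrements forces \<open>P (X 0 = a, T > t)\<close>, and with it \<open>m t\<close>, to \<open>0\<close>.\<close>

lemma cond_expectation_hitting_time:
  assumes fin: "finite S" and a: "a \<in> S" "a \<noteq> b" and b: "b \<in> S"
    and pos: "prob {\<omega> \<in> space P. X 0 \<omega> = a} > 0"
    and h_nonneg: "\<And>x. x \<in> S \<Longrightarrow> h x \<ge> 0" and h_b: "h b = 0"
    and h_rec: "\<And>x. x \<in> S \<Longrightarrow> x \<noteq> b \<Longrightarrow> h x = 1 + (\<Sum>y\<in>S. p x y * h y)"
  shows "cond_expectation P (\<lambda>\<omega>. ennreal_of_enat (hitting_time X b \<omega>)) {\<omega> \<in> space P. X 0 \<omega> = a}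
    = ennreal (h a)"
proof -
  \<comment> \<open>\<open>A t\<close> is the event of starting at \<open>a\<close> and not hitting
    \<open>b\<close> up to time \<open>t\<close>; \<open>\<mu> t\<close> is the distribution of
    \<open>X t\<close> on it, that is, of the chain killed at \<open>b\<close>.\<close>
  define A where "A t = {\<omega> \<in> space P. X 0 \<omega> = a \<and> (\<forall>s\<le>t. X s \<omega> \<noteq> b)}" for t
  define \<mu> where "\<mu> t x = prob {\<omega> \<in> A t. X t \<omega> = x}" for t x
  define m where "m t = (\<Sum>x\<in>S. \<mu> t x * h x)" for t
  define Z where "Z = {\<omega> \<in> space P. X 0 \<omega> = a}"
  have [measurable]: "A t \<in> sets P" for t unfolding A_def by measurable
  have A_X [measurable]: "{\<omega> \<in> A t. X s \<omega> = x} \<in> sets P" for t s x unfolding A_def by measurable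
  have [measurable]: "Z \<in> sets P" unfolding Z_def by measurable
  have A_space: "A t \<subseteq> space P" for t unfolding A_def by auto

  have decomp: "prob B = (\<Sum>x\<in>S. prob {\<omega> \<in> B. X t \<omega> = x})"
    if "B \<subseteq> space P" "\<And>x. {\<omega> \<in> B. X t \<omega> = x} \<in> sets P" for B t
  proof -
    have "B = (\<Union>x\<in>S. {\<omega> \<in> B. X t \<omega> = x})" using X_in_states that(1) by auto
    also have "prob \<dots> = (\<Sum>x\<in>S. prob {\<omega> \<in> B. X t \<omega> = x})"
      using that fin by (intro finite_measure_finite_Union) (auto simp: disjoint_family_on_def)
    finally show ?thesis .
  qed
  have \<mu>_step: "prob {\<omega> \<in> A t. X t \<omega> = x \<and> X (Suc t) \<omega> = y} = \<mu> t x * p x y"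
    if "x \<in> S" "y \<in> S" for t x y
  proof -
    define H where "H = {g \<in> {..t} \<rightarrow>\<^sub>E S. g 0 = a \<and> (\<forall>s\<le>t. g s \<noteq> b) \<and> g t = x}"
    have H: "restrict (\<lambda>s. X s \<omega>) {..t} \<in> H \<longleftrightarrow> \<omega> \<in> A t \<and> X t \<omega> = x" if "\<omega> \<in> space P" for \<omega>
      using that X_in_states[OF that] by (auto simp: H_def A_def)
    have "prob {\<omega> \<in> space P. restrict (\<lambda>s. X s \<omega>) {..t} \<in> H \<and> X (Suc t) \<omega> = y}
      = prob {\<omega> \<in> space P. restrict (\<lambda>s. X s \<omega>) {..t} \<in> H} * p x y"
      using fin that by (rule prob_markov_step) (auto simp: H_def)
    moreover have "{\<omega> \<in> space P. restrict (\<lambda>s. X s \<omega>) {..t} \<in> H \<and> X (Suc t) \<omega> = y}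
      = {\<omega> \<in> A t. X t \<omega> = x \<and> X (Suc t) \<omega> = y}"
      "{\<omega> \<in> space P. restrict (\<lambda>s. X s \<omega>) {..t} \<in> H} = {\<omega> \<in> A t. X t \<omega> = x}"
      using H A_space by blast+
    ultimately show ?thesis by (simp add: \<mu>_def)
  qed
  have \<mu>_Suc: "\<mu> (Suc t) y = (\<Sum>x\<in>S. \<mu> t x * p x y)" if "y \<in> S" "y \<noteq> b" for t y
  proof -
    \<comment> \<open>Ending in \<open>y \<noteq> b\<close> makes avoidance of \<open>b\<close> at
      time \<open>Suc t\<close> automatic.\<close>
    have "{\<omega> \<in> A (Suc t). X (Suc t) \<omega> = y} = {\<omega> \<in> A t. X (Suc t) \<omega> = y}"
      using that by (auto simp: A_def le_Suc_eq)
    then have "\<mu> (Suc t) y = prob {\<omega> \<in> A t. X (Suc t) \<omega> = y}" by (simp add: \<mu>_def)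
    also have "\<dots> = (\<Sum>x\<in>S. prob {\<omega> \<in> {\<omega> \<in> A t. X (Suc t) \<omega> = y}. X t \<omega> = x})"
    proof (rule decomp)
      show "{\<omega> \<in> A t. X (Suc t) \<omega> = y} \<subseteq> space P" using A_space by auto
      fix x
      have "{\<omega> \<in> {\<omega> \<in> A t. X (Suc t) \<omega> = y}. X t \<omega> = x}
          = {\<omega> \<in> A t. X (Suc t) \<omega> = y} \<inter> {\<omega> \<in> A t. X t \<omega> = x}" by auto
      then show "{\<omega> \<in> {\<omega> \<in> A t. X (Suc t) \<omega> = y}. X t \<omega> = x} \<in> sets P"
        using A_X by (simp only:) (rule sets.Int)
    qed
    also have "\<dots> = (\<Sum>x\<in>S. \<mu> t x * p x y)"
      using \<open>y \<in> S\<close> by (intro sum.cong refl) (simp add: \<mu>_step[symmetric] conj_ac)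
    finally show ?thesis .
  qed
  have \<mu>_b: "\<mu> t b = 0" for t
  proof -
    have "{\<omega> \<in> A t. X t \<omega> = b} = {}" by (auto simp: A_def)
    then show ?thesis by (simp only: \<mu>_def measure_empty)
  qed
  have prob_A: "prob (A t) = (\<Sum>x\<in>S. \<mu> t x)" for t
    unfolding \<mu>_def by (rule decomp) (use A_space in auto)

  have m_step: "m t = prob (A t) + m (Suc t)" for t
  proof -
    have "m t = (\<Sum>x\<in>S. \<mu> t x + (\<Sum>y\<in>S. \<mu> t x * p x y * h y))"
      unfolding m_def
    proof (rule sum.cong)
      fix x assume "x \<in> S"
      then show "\<mu> t x * h x = \<mu> t x + (\<Sum>y\<in>S. \<mu> t x * p x y * h y)"
        \<comment> \<open>The one-step equation is not assumed at \<open>b\<close>, but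
          \<open>\<mu> t\<close> has no mass there.\<close>
        by (cases "x = b") (simp_all add: \<mu>_b h_rec algebra_simps sum_distrib_left)
    qed simp
    also have "\<dots> = prob (A t) + (\<Sum>y\<in>S. (\<Sum>x\<in>S. \<mu> t x * p x y) * h y)"
      unfolding sum.distrib prob_A sum_distrib_right by (subst sum.swap) simp
    also have "(\<Sum>y\<in>S. (\<Sum>x\<in>S. \<mu> t x * p x y) * h y) = m (Suc t)"
      unfolding m_def by (rule sum.cong) (use \<mu>_Suc h_b in \<open>auto, metis\<close>)
    finally show ?thesis .
  qed
  have m_nonneg: "m t \<ge> 0" for t
    unfolding m_def \<mu>_def by (intro sum_nonneg mult_nonneg_nonneg h_nonneg) auto
  have partial: "(\<Sum>t<N. prob (A t)) = m 0 - m N" for N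
  proof (induction N)
    case (Suc N)
    then show ?case using m_step[of N] by simp
  qed simp
  have "summable (\<lambda>t. prob (A t))"
    by (rule summableI_nonneg_bounded[where x = "m 0"]) (use partial m_nonneg in auto)
  then have A_0: "(\<lambda>t. prob (A t)) \<longlonglongrightarrow> 0" by (rule summable_LIMSEQ_zero)
  \<comment> \<open>Since \<open>S\<close> is finite, \<open>m t\<close> is at most
    \<open>prob (A t)\<close> times the constant \<open>\<Sum>x\<in>S. h x\<close>.\<close>
  have m_0: "m \<longlonglongrightarrow> 0"
  proof (rule tendsto_sandwich[where f = "\<lambda>_. 0"])
    show "(\<lambda>t. (\<Sum>x\<in>S. prob (A t) * h x)) \<longlonglongrightarrow> 0"
      by (intro tendsto_null_sum tendsto_mult_left_zero A_0)
    show "\<forall>\<^sub>F t in sequentially. m t \<le> (\<Sum>x\<in>S. prob (A t) * h x)"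
      unfolding m_def \<mu>_def
      by (intro always_eventually allI sum_mono mult_right_mono finite_measure_mono h_nonneg) auto
  qed (use m_nonneg in auto)
  have \<mu>_0: "\<mu> 0 x = (if x = a then prob Z else 0)" for x
  proof -
    have "{\<omega> \<in> A 0. X 0 \<omega> = x} = (if x = a then Z else {})"
      using a by (auto simp: A_def Z_def)
    then show ?thesis by (simp add: \<mu>_def)
  qed
  have "m 0 = prob Z * h a"
    unfolding m_def \<mu>_0 using fin a by (simp add: if_distrib[where f = "\<lambda>z. z * _"] cong: if_cong)
  moreover have "(\<lambda>N. m 0 - m N) \<longlonglongrightarrow> m 0 - 0" by (intro tendsto_intros m_0)
  ultimately have sums: "(\<lambda>t. prob (A t)) sums (prob Z * h a)"
    unfolding sums_def partial by simp

  have Z_pos: "prob Z > 0" using pos by (simp add: Z_def)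
  have em: "emeasure (uniform_measure P Z) {\<omega> \<in> space (uniform_measure P Z). enat t < hitting_time X b \<omega>}
      = ennreal (prob (A t) / prob Z)" for t
  proof -
    have "Z \<inter> {\<omega> \<in> space P. enat t < hitting_time X b \<omega>} = A t"
      by (auto simp: Z_def A_def less_hitting_time_iff)
    then show ?thesis
      using sets_hitting_time_greater Z_pos
      by (simp add: emeasure_eq_measure divide_ennreal)
  qed
  have "hitting_time X b \<in> measurable (uniform_measure P Z) (count_space UNIV)"
    using measurable_hitting_time by (simp add: measurable_def)
  \<comment> \<open>The expectation of an \<open>enat\<close>-valued variable is the sum of its tail
    probabilities, here under the measure conditioned on \<open>Z\<close>.\<close>
  then have "(\<integral>\<^sup>+ \<omega>. ennreal_of_enat (hitting_time X b \<omega>) \<partial>uniform_measure P Z)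
      = (\<Sum>t. ennreal (prob (A t) / prob Z))"
    by (subst nn_integral_enat_function) (simp_all only: em)
  also have "\<dots> = ennreal (prob Z * h a / prob Z)"
    using Z_pos by (intro suminf_ennreal_eq sums_divide sums) auto
  finally show ?thesis
    using Z_pos by (simp add: cond_expectation_def Z_def)
qed

end


section \<open>The closed formula and its recurrence\<close>

text \<open>The half-open range makes the sum empty at \<open>L = M\<close>, which is the boundary
  value 0 at the target.\<close>

definition expected_hitting_time :: "nat \<Rightarrow> nat \<Rightarrow> nat \<Rightarrow> real" where
  "expected_hitting_time n M L = (\<Sum>k = L..<M. (real n - 1) ^ (k + 1) / real ((M - 1) choose k)
        * (\<Sum>i = 0..k. real (M choose i) / (real n - 1) ^ i))"

lemma expected_hitting_time_nonneg: "n \<ge> 1 \<Longrightarrow> expected_hitting_time n M L \<ge> 0"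
  unfolding expected_hitting_time_def by (intro sum_nonneg mult_nonneg_nonneg divide_nonneg_nonneg) auto

lemma expected_hitting_time_diff:
  "L < M \<Longrightarrow> expected_hitting_time n M L - expected_hitting_time n M (Suc L)
    = (real n - 1) ^ (L + 1) / real ((M - 1) choose L)
        * (\<Sum>i = 0..L. real (M choose i) / (real n - 1) ^ i)"
  unfolding expected_hitting_time_def by (simp add: sum.atLeast_Suc_lessThan)

text \<open>For \<open>L = 0\<close> the junk value \<open>expected_hitting_time n M (0 - 1)\<close> has coefficient \<open>0\<close>.\<close>

lemma expected_hitting_time_rec:
  assumes n: "n \<ge> 2" and L: "L < M"
  defines "E \<equiv> expected_hitting_time n M"
  shows "(real n - 1) * real M * E L = (real n - 1) * real M + real L * (real n - 1) * E (L - 1)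
    + real (M - L) * (E (Suc L) + (real n - 2) * E L)"
proof -
  define q where "q = real n - 1"
  define D where "D k = q ^ (k + 1) / real ((M - 1) choose k)
        * (\<Sum>i = 0..k. real (M choose i) / q ^ i)" for k
  have q: "q > 0" using n by (simp add: q_def)
  have D: "E k - E (Suc k) = D k" if "k < M" for k
    using expected_hitting_time_diff[OF that] by (simp add: E_def D_def q_def)
  \<comment> \<open>Absorption replaces \<open>(M - 1) choose L\<close> by
    \<open>M choose L\<close>, so that the term \<open>i = L\<close> of the sum becomes exactly
    \<open>q * real M\<close>.\<close>
  have up: "real (M - L) * D L = real M * q ^ Suc L / real (M choose L) * (\<Sum>i = 0..L. real (M choose i) / q ^ i)"
  proof -
    have "(M - L) * (M choose L) = M * ((M - 1) choose L)"
      using L binomial_absorb_comp[of M L] by simp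
    then have "real (M - L) * real (M choose L) = real M * real ((M - 1) choose L)"
      by (metis of_nat_mult)
    moreover have "(M choose L) > 0" "((M - 1) choose L) > 0" using L by auto
    ultimately have "real (M - L) / real ((M - 1) choose L) = real M / real (M choose L)"
      by (simp add: field_simps)
    moreover have "real (M - L) * D L = real (M - L) / real ((M - 1) choose L)
        * (q ^ Suc L * (\<Sum>i = 0..L. real (M choose i) / q ^ i))"
      by (simp add: D_def)
    ultimately show ?thesis by simp
  qed
  \<comment> \<open>Splitting off the term \<open>i = L\<close> in \<open>up\<close> leaves a
    multiple of the sum up to \<open>L - 1\<close>, which the second absorption identity recognises
    as \<open>real L * q * D (L - 1)\<close>. For \<open>L = 0\<close> nothing is left.\<close>
  have "real (M - L) * D L = q * real M + real L * q * (E (L - 1) - E L)"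
  proof (cases L)
    case 0
    then show ?thesis unfolding up by simp
  next
    case (Suc l)
    have "Suc l * (M choose Suc l) = M * ((M - 1) choose l)"
      using times_binomial_minus1_eq[of "Suc l" M] by simp
    then have "real (Suc l) * real (M choose Suc l) = real M * real ((M - 1) choose l)"
      by (metis of_nat_mult)
    moreover have pos: "(M choose Suc l) > 0" "((M - 1) choose l) > 0" using L Suc by auto
    ultimately have *: "real (Suc l) / real ((M - 1) choose l) = real M / real (M choose Suc l)"
      by (simp add: field_simps)
    have "real L * q * (E (L - 1) - E L) = q * (real (Suc l) * D l)"
      using D[of l] L Suc by simp
    also have "real (Suc l) * D l = real (Suc l) / real ((M - 1) choose l)
        * (q ^ Suc l * (\<Sum>i = 0..l. real (M choose i) / q ^ i))"
      by (simp add: D_def)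
    also have "\<dots> = real M * q ^ Suc l / real (M choose Suc l) * (\<Sum>i = 0..l. real (M choose i) / q ^ i)"
      unfolding * by simp
    finally show ?thesis unfolding up using pos q Suc by (simp add: distrib_left)
  qed
  moreover have "real (M - L) * (E (Suc L) + (real n - 2) * E L)
      = (real M - real L) * q * E L - real (M - L) * D L"
  proof -
    \<comment> \<open>Here \<open>real n - 2 = q - 1\<close> and
      \<open>E (Suc L) = E L - D L\<close>.\<close>
    have *: "E (Suc L) + (real n - 2) * E L = q * E L - D L"
      using D[OF L] by (simp add: q_def algebra_simps)
    show ?thesis unfolding * using L by (simp add: of_nat_diff algebra_simps)
  qed
  ultimately show ?thesis
    unfolding q_def[symmetric] by (simp add: algebra_simps)
qed

section \<open>One-step averages and reduction to the number of matches\<close>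

text \<open>A neighbour of \<open>x\<close> corresponds to exactly one pair of a moved ball and its
  new urn, and all neighbours have the same transition probability.\<close>

lemma sum_over_neighbours:
  fixes f :: "(nat \<Rightarrow> nat) \<Rightarrow> real"
  assumes x: "x \<in> configs n M"
  shows "(\<Sum>y\<in>configs n M. ehrenfest_trans n M x y * f y)
    = (\<Sum>i=1..M. \<Sum>v\<in>{1..n} - {x i}. f (x(i := v))) / ((real n - 1) * real M)"
proof -
  define N where "N = {y \<in> configs n M. card {i \<in> {1..M}. x i \<noteq> y i} = 1}"
  define A where "A = (SIGMA i:{1..M}. {1..n} - {x i})"
  have fin: "finite (configs n M)" by (simp add: configs_def finite_PiE)
  have x_upd: "x(i := v) \<in> configs n M" if "i \<in> {1..M}" "v \<in> {1..n}" for i v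
    using x that by (auto simp: configs_def PiE_def extensional_def)
  have bij: "bij_betw (\<lambda>(i, v). x(i := v)) A N"
  proof (rule bij_betw_imageI)
    show "inj_on (\<lambda>(i, v). x(i := v)) A"
      unfolding inj_on_def A_def by (auto simp: fun_eq_iff split: if_splits)
    show "(\<lambda>(i, v). x(i := v)) ` A = N"
    proof (intro equalityI subsetI)
      fix y assume "y \<in> (\<lambda>(i, v). x(i := v)) ` A"
      then obtain i v where "(i, v) \<in> A" "y = x(i := v)" by auto
      then have iv: "i \<in> {1..M}" "v \<in> {1..n}" "v \<noteq> x i" "y = x(i := v)"
        by (auto simp: A_def)
      then have "{j \<in> {1..M}. x j \<noteq> y j} = {i}" by auto
      then show "y \<in> N" using x_upd iv by (simp add: N_def)
    next
      fix y assume "y \<in> N"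
      then obtain i where i: "{j \<in> {1..M}. x j \<noteq> y j} = {i}" and y: "y \<in> configs n M"
        by (auto simp: N_def card_1_singleton_iff)
      have "y = x(i := y i)"
      proof
        fix j
        show "y j = (x(i := y i)) j"
          using i x y by (cases "j \<in> {1..M}") (auto simp: configs_def PiE_def extensional_def)
      qed
      moreover have "(i, y i) \<in> A"
      proof -
        have "i \<in> {1..M}" "x i \<noteq> y i" using i by blast+
        then show ?thesis using PiE_mem[OF y[unfolded configs_def], of i] by (auto simp: A_def)
      qed
      ultimately show "y \<in> (\<lambda>(i, v). x(i := v)) ` A" by (metis (no_types, lifting) case_prod_conv image_eqI)
    qed
  qed
  have "(\<Sum>y\<in>configs n M. ehrenfest_trans n M x y * f y) = (\<Sum>y\<in>N. f y / ((real n - 1) * real M))"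
    using fin unfolding N_def by (subst sum.inter_filter) (auto simp: ehrenfest_trans_def intro!: sum.cong)
  also have "\<dots> = (\<Sum>y\<in>N. f y) / ((real n - 1) * real M)" by (simp add: sum_divide_distrib)
  also have "(\<Sum>y\<in>N. f y) = (\<Sum>(i, v)\<in>A. f (x(i := v)))"
    by (subst sum.reindex_bij_betw[OF bij, symmetric]) (simp add: case_prod_unfold)
  also have "\<dots> = (\<Sum>i=1..M. \<Sum>v\<in>{1..n} - {x i}. f (x(i := v)))"
    unfolding A_def by (subst sum.Sigma) auto
  finally show ?thesis .
qed

definition matches :: "nat \<Rightarrow> (nat \<Rightarrow> nat) \<Rightarrow> (nat \<Rightarrow> nat) \<Rightarrow> nat" where
  "matches M x b = card {i \<in> {1..M}. x i = b i}"

lemma matches_eq_iff: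
  assumes "x \<in> configs n M" "b \<in> configs n M"
  shows "matches M x b = M \<longleftrightarrow> x = b"
proof
  assume "matches M x b = M"
  then have "{i \<in> {1..M}. x i = b i} = {1..M}"
    by (intro card_subset_eq) (auto simp: matches_def)
  then show "x = b"
    using assms unfolding configs_def by (intro PiE_ext) auto
next
  assume "x = b"
  then have "{i \<in> {1..M}. x i = b i} = {1..M}" by auto
  then show "matches M x b = M" by (simp add: matches_def)
qed

lemma matches_le: "matches M x b \<le> M"
  unfolding matches_def by (rule order_trans[OF card_mono[of "{1..M}"]]) auto

text \<open>The three cases are a ball leaving its target urn, reaching it, and moving between two
  wrong urns. In the first, ball \<open>i\<close> itself is counted, so the subtraction is not
  truncated.\<close>

lemma matches_upd:
  assumes "i \<in> {1..M}"
  shows "x i = b i \<Longrightarrow> v \<noteq> x i \<Longrightarrow> matches M (x(i := v)) b = matches M x b - 1"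
    and "x i \<noteq> b i \<Longrightarrow> matches M (x(i := b i)) b = Suc (matches M x b)"
    and "x i \<noteq> b i \<Longrightarrow> v \<noteq> b i \<Longrightarrow> matches M (x(i := v)) b = matches M x b"
proof -
  show "matches M (x(i := v)) b = matches M x b - 1" if "x i = b i" "v \<noteq> x i"
  proof -
    have "{j \<in> {1..M}. (x(i := v)) j = b j} = {j \<in> {1..M}. x j = b j} - {i}" using that by auto
    then show ?thesis using that assms by (simp add: matches_def)
  qed
  show "matches M (x(i := b i)) b = Suc (matches M x b)" if "x i \<noteq> b i"
  proof -
    have "{j \<in> {1..M}. (x(i := b i)) j = b j} = insert i {j \<in> {1..M}. x j = b j}" using assms by auto
    then show ?thesis using that by (simp add: matches_def)
  qed
  show "matches M (x(i := v)) b = matches M x b" if "x i \<noteq> b i" "v \<noteq> b i"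
  proof -
    have "{j \<in> {1..M}. (x(i := v)) j = b j} = {j \<in> {1..M}. x j = b j}" using that by auto
    then show ?thesis by (simp add: matches_def)
  qed
qed

text \<open>Each of the \<open>L\<close> matched balls has \<open>n - 1\<close> moves, all losing a
  match; each other ball has one move that gains a match and \<open>n - 2\<close> neutral
  ones.\<close>

lemma sum_over_neighbours_matches:
  fixes h :: "nat \<Rightarrow> real"
  assumes n: "n \<ge> 2" and x: "x \<in> configs n M" and b: "b \<in> configs n M"
  defines "L \<equiv> matches M x b"
  shows "(\<Sum>i=1..M. \<Sum>v\<in>{1..n} - {x i}. h (matches M (x(i := v)) b))
    = real L * (real n - 1) * h (L - 1) + real (M - L) * (h (Suc L) + (real n - 2) * h L)"
proof -
  have inner: "(\<Sum>v\<in>{1..n} - {x i}. h (matches M (x(i := v)) b))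
    = (if x i = b i then (real n - 1) * h (L - 1) else h (Suc L) + (real n - 2) * h L)"
    if i: "i \<in> {1..M}" for i
  proof (cases "x i = b i")
    case True
    have "x i \<in> {1..n}" using x i by (auto simp: configs_def)
    moreover have "(\<Sum>v\<in>{1..n} - {x i}. h (matches M (x(i := v)) b)) = (\<Sum>v\<in>{1..n} - {x i}. h (L - 1))"
      using matches_upd(1)[OF i, of x b] True by (intro sum.cong) (auto simp: L_def)
    ultimately show ?thesis using True n by (simp add: of_nat_diff)
  next
    case False
    have xi: "x i \<in> {1..n}" and bi: "b i \<in> {1..n}" using x b i by (auto simp: configs_def)
    \<comment> \<open>The move to the target urn \<open>b i\<close> is isolated; the remaining moves
      keep the number of matches.\<close>
    have "(\<Sum>v\<in>{1..n} - {x i}. h (matches M (x(i := v)) b))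
      = h (matches M (x(i := b i)) b) + (\<Sum>v\<in>{1..n} - {x i} - {b i}. h (matches M (x(i := v)) b))"
      using bi False by (intro sum.remove) auto
    also have "(\<Sum>v\<in>{1..n} - {x i} - {b i}. h (matches M (x(i := v)) b))
        = (\<Sum>v\<in>{1..n} - {x i} - {b i}. h L)"
      using matches_upd(3)[OF i, of x b] False by (intro sum.cong) (auto simp: L_def)
    also have "\<dots> = (real n - 2) * h L"
    proof -
      have "card ({1..n} - {x i} - {b i}) = n - 2" using xi bi False by (simp add: card_Diff_singleton)
      then show ?thesis using n by (simp add: of_nat_diff)
    qed
    finally show ?thesis using False matches_upd(2)[OF i, of x b] by (simp add: L_def fun_upd_def)
  qed
  have "card ({1..M} \<inter> - {i. x i = b i}) = M - L"
  proof -
    have "{1..M} \<inter> - {i. x i = b i} = {1..M} - {i \<in> {1..M}. x i = b i}" by auto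
    moreover have "card ({1..M} - {i \<in> {1..M}. x i = b i}) = M - L"
      by (subst card_Diff_subset) (auto simp: L_def matches_def)
    ultimately show ?thesis by simp
  qed
  moreover have "card ({1..M} \<inter> {i. x i = b i}) = L"
    by (simp add: L_def matches_def Int_def conj_commute)
  moreover have "(\<Sum>i=1..M. \<Sum>v\<in>{1..n} - {x i}. h (matches M (x(i := v)) b))
    = (\<Sum>i=1..M. if x i = b i then (real n - 1) * h (L - 1) else h (Suc L) + (real n - 2) * h L)"
    by (intro sum.cong refl inner)
  ultimately show ?thesis by (simp add: sum.If_cases)
qed


text \<open>The recurrence in \<open>L\<close> is the one-step equation multiplied by
  \<open>(real n - 1) * real M\<close>; \<open>x \<noteq> b\<close> supplies the condition
  \<open>L < M\<close>.\<close>

lemma expected_hitting_time_matches_rec: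
  assumes n: "n \<ge> 2" and x: "x \<in> configs n M" and b: "b \<in> configs n M" and "x \<noteq> b"
  defines "h \<equiv> \<lambda>y. expected_hitting_time n M (matches M y b)"
  shows "h x = 1 + (\<Sum>y\<in>configs n M. ehrenfest_trans n M x y * h y)"
proof -
  have L: "matches M x b < M"
    using matches_le[of M x b] matches_eq_iff[OF x b] \<open>x \<noteq> b\<close> by linarith
  have pos: "(real n - 1) * real M > 0" using n L by simp
  have "(real n - 1) * real M * h x
    = (real n - 1) * real M + (\<Sum>i=1..M. \<Sum>v\<in>{1..n} - {x i}. h (x(i := v)))"
    unfolding h_def sum_over_neighbours_matches[OF n x b]
    using expected_hitting_time_rec[OF n L] by simp
  then have "h x = ((real n - 1) * real M + (\<Sum>i=1..M. \<Sum>v\<in>{1..n} - {x i}. h (x(i := v))))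
      / ((real n - 1) * real M)"
    using pos by (metis less_irrefl nonzero_mult_div_cancel_left)
  also have "\<dots> = 1 + (\<Sum>i=1..M. \<Sum>v\<in>{1..n} - {x i}. h (x(i := v))) / ((real n - 1) * real M)"
    using less_imp_neq[OF pos] by (subst add_divide_distrib, subst divide_self) simp_all
  finally show ?thesis unfolding sum_over_neighbours[OF x] .
qed

theorem theorem1p1:
  fixes n M L :: nat
    and P :: "'w measure" and X :: "nat \<Rightarrow> 'w \<Rightarrow> nat \<Rightarrow> nat"
    and a b :: "nat \<Rightarrow> nat"
  assumes "n \<ge> 2" and "M \<ge> 1"
    and "ehrenfest_chain n M P X"
    and "a \<in> configs n M" and "b \<in> configs n M" and "a \<noteq> b"
    and "measure P {\<omega> \<in> space P. X 0 \<omega> = a} > 0"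
    and "L = card {i \<in> {1..M}. a i = b i}"
  shows "cond_expectation P (\<lambda>\<omega>. ennreal_of_enat (hitting_time X b \<omega>)) {\<omega> \<in> space P. X 0 \<omega> = a}
    = ennreal (\<Sum>k = L..M - 1. (real n - 1) ^ (k + 1) / real ((M - 1) choose k)
        * (\<Sum>i = 0..k. real (M choose i) / (real n - 1) ^ i))"
proof -
  interpret discrete_markov_chain P "configs n M" "ehrenfest_trans n M" X
    using assms(3) by (simp add: ehrenfest_chain_def)
  have "cond_expectation P (\<lambda>\<omega>. ennreal_of_enat (hitting_time X b \<omega>)) {\<omega> \<in> space P. X 0 \<omega> = a}
      = ennreal (expected_hitting_time n M (matches M a b))"
  proof (rule cond_expectation_hitting_time)
    show "finite (configs n M)" by (simp add: configs_def finite_PiE)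
    show "expected_hitting_time n M (matches M b b) = 0"
      using matches_eq_iff[OF assms(5,5)] by (simp add: expected_hitting_time_def)
    show "expected_hitting_time n M (matches M x b) \<ge> 0" for x
      using assms(1) by (intro expected_hitting_time_nonneg) simp
    show "expected_hitting_time n M (matches M x b)
        = 1 + (\<Sum>y\<in>configs n M. ehrenfest_trans n M x y * expected_hitting_time n M (matches M y b))"
      if "x \<in> configs n M" "x \<noteq> b" for x
      using assms(1) that(1) assms(5) that(2) by (rule expected_hitting_time_matches_rec)
  qed (fact assms)+
  \<comment> \<open>\<open>M \<ge> 1\<close> keeps \<open>M - 1\<close> from truncating, so the two
    index ranges agree.\<close>
  moreover have "{L..<M} = {L..M - 1}" using assms(2) by auto
  ultimately show ?thesis
    by (simp only: expected_hitting_time_def matches_def assms(8))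
qed

end
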